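(* Let $m,n$ be even integers and $k$ an odd integer with $1\le k\le\min(m,n)$, and let $m'=m+n-2k$. Let $$X=c_{m,n,k}\left(\tfrac m2+1,\tfrac n2-1\right)=(-1)^{\frac{k+1}{2}}\,\frac{2(k+1)(m-k+1)}{m(m+2)}\,\frac{\left(\frac{m+n-k+1}{2}\right)!}{\left(\frac{m-k+1}{2}\right)!\left(\frac{n-k-1}{2}\right)!\left(\frac{k+1}{2}\right)!}$$ be the entry of $M(m,n,k)$ directly below the central entry (the central entry itself is $0$). For $1\le s\le m/2$, let $A_sX$ be the entry of $M(m,n,k)$ lying $s$ rows below the central entry in the same column (that is, $c_{m,n,k}(\frac m2+s,\frac n2-s)$), and let $B_sX$ be the entry immediately to the right of it (that is, $c_{m,n,k}(\frac m2+s,\frac n2-s+1)$). Then, with $\lambda_s=s(s+2)$, $$A_1=1,\qquad B_1=1,$$ and, for $1\le s<m/2$, $$A_{s+1}=\frac{(\lambda_{m'}-\lambda_m+\lambda_{2s})A_s-(\lambda_n-\lambda_{2s-2})B_s}{\lambda_m-\lambda_{2s}},\qquad B_{s+1}=\frac{\lambda_{m'}A_s-(\lambda_n-\lambda_{2s-2})B_s}{\lambda_m-\lambda_{2s}}.$$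
   Context: For integers $m,n,k,i,j$ with $0\le k\le\min(m,n)$, $0\le i\le m$, $0\le j\le n$, $0\le i+j-k\le m+n-2k$, define $$c_{m,n,k}(i,j)=\sum_{l=0}^{k}(-1)^l\binom{i+j-k}{i-l}\binom{m-l}{k-l}\binom{n-k+l}{l},$$ where $\binom{a}{b}=0$ if $b<0$ or $b>a$. The matrix $M(m,n,k)$ has $m+1$ rows and $m+n-2k+1$ columns; its entry in row $i+1$ and column $i+j-k+1$ is $c_{m,n,k}(i,j)$ when $0\le j\le n$, and $0$ when $j<0$ or $j>n$ (so $c_{m,n,k}(i,j)$ is extended by zero to all entries of $M(m,n,k)$). The central entry is $c_{m,n,k}(\frac m2,\frac n2)$. *)

theory Defs
  imports Complex_Main "Jordan_Normal_Form.Matrix"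
begin

definition ibinom :: "int \<Rightarrow> int \<Rightarrow> int" where
  "ibinom a b = (if 0 \<le> b \<and> b \<le> a then int (nat a choose nat b) else 0)"

(* The defining sum; only meant for 0 \<le> i \<le> m, 0 \<le> j \<le> n, 0 \<le> i + j - k \<le> m + n - 2 k. *)
definition coef :: "nat \<Rightarrow> nat \<Rightarrow> nat \<Rightarrow> int \<Rightarrow> int \<Rightarrow> int" where
  "coef m n k i j =
    (\<Sum>l = 0..k. (- 1) ^ l * ibinom (i + j - int k) (i - int l)
       * ibinom (int m - int l) (int k - int l) * ibinom (int n - int k + int l) (int l))"

(* Extension by zero to the values of j outside [0, n] that occur in the matrix below. *)
definition coef_ext :: "nat \<Rightarrow> nat \<Rightarrow> nat \<Rightarrow> int \<Rightarrow> int \<Rightarrow> int" where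
  "coef_ext m n k i j = (if 0 \<le> j \<and> j \<le> int n then coef m n k i j else 0)"

(* Matrix indices start at 0, so the entry for (i, j) is at position (i, i + j - k);
   position (i, q) therefore carries j = q + k - i. *)
definition M_mat :: "nat \<Rightarrow> nat \<Rightarrow> nat \<Rightarrow> int mat" where
  "M_mat m n k = mat (m + 1) (m + n - 2 * k + 1)
     (\<lambda>(i, q). coef_ext m n k (int i) (int q + int k - int i))"

definition lam :: "rat \<Rightarrow> rat" where
  "lam s = s * (s + 2)"

end

theory Submission
  imports Defs
begin

text \<open>
  Up to normalisation, \<open>coef m n k\<close> is the matrix of the \<open>k\<close>-th transvectant of binary forms of
  degrees \<open>m\<close> and \<open>n\<close>, in the bases \<open>x ^ i * y ^ (m - i) / i!\<close>. Equivariance under the two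
  nilpotent generators of \<open>sl(2)\<close> gives Pascal's rule and a weighted companion (\<open>coef_raise\<close>),
  which together are the claimed recursion for \<open>A\<close> and \<open>B\<close>. Factoring the transvectant through
  Cayley's Omega operator relates level \<open>k + 1\<close> to level \<open>k\<close> (\<open>coef_Suc\<close>); applied twice at the
  centre it moves from \<open>k\<close> to \<open>k + 2\<close>, and induction yields the vanishing of the central entry
  and the value of \<open>X\<close>.
\<close>

section \<open>Binomial coefficients with integer arguments\<close>

lemma ibinom_absorb: "b * ibinom a b = a * ibinom (a - 1) (b - 1)"
proof (cases "1 \<le> b \<and> b \<le> a")
  case True
  then obtain p q where "a = int (Suc p)" "b = int (Suc q)"
    using True by (intro that[of "nat (a - 1)" "nat (b - 1)"]) auto
  moreover have "int (Suc q) * int (Suc p choose Suc q) = int (Suc p) * int (p choose q)"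
    by (metis Suc_times_binomial of_nat_mult)
  ultimately show ?thesis
    using True by (simp add: ibinom_def nat_add_distrib del: binomial_Suc_Suc)
next
  case False
  then show ?thesis
    by (auto simp: ibinom_def)
qed

text \<open>The bound on \<open>a\<close> excludes the apex \<open>a = b = 0\<close> of the
  triangle, where the left side is 1 and both summands on the right are 0.\<close>

lemma ibinom_pascal:
  assumes "a \<ge> 1"
  shows "ibinom a b = ibinom (a - 1) (b - 1) + ibinom (a - 1) b"
proof (cases "1 \<le> b \<and> b \<le> a")
  case True
  define p q where "p = nat (a - 1)" and "q = nat (b - 1)"
  have ab: "a = int (Suc p)" "b = int (Suc q)"
    using True by (auto simp: p_def q_def)
  have "ibinom (int p) (int (Suc q)) = int (p choose Suc q)"
    by (simp add: ibinom_def del: of_nat_Suc)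
  with True show ?thesis
    unfolding ab by (auto simp: ibinom_def nat_add_distrib)
next
  case False
  then show ?thesis
    using assms by (auto simp: ibinom_def)
qed

lemma ibinom_absorb_comp: "(a - b) * ibinom a b = a * ibinom (a - 1) b"
proof (cases "a \<ge> 1")
  case True
  then show ?thesis
    using ibinom_absorb[of b a] ibinom_pascal[of a b] by (simp add: algebra_simps)
next
  case False
  then show ?thesis
    by (auto simp: ibinom_def)
qed

lemma ibinom_absorb_step: "b * ibinom a b = (a - b + 1) * ibinom a (b - 1)"
  using ibinom_absorb[of b a] ibinom_absorb_comp[of a "b - 1"] by (simp add: algebra_simps)

section \<open>Transvectant coefficients: Pascal rule, Omega step, raising identity\<close>

lemma coef_zero: "coef m n 0 i j = ibinom (i + j) i"
  by (simp add: coef_def ibinom_def)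

text \<open>For \<open>l \<le> k\<close> the upper index \<open>i + j - k\<close> lies below
  \<open>i - l\<close>, so each summand vanishes. For negative \<open>j\<close> the extension by
  zero thus agrees with the defining sum.\<close>

lemma coef_eq_0:
  assumes "j < 0"
  shows "coef m n k i j = 0"
  using assms by (auto simp: coef_def ibinom_def)

text \<open>Equivariance under \<open>y * d/dx\<close>, which lowers \<open>i\<close> with weight 1
  in the chosen bases. Only the first binomial of each summand involves \<open>i\<close> and
  \<open>j\<close>, so Pascal's rule applies termwise; the assumption keeps its upper index
  positive.\<close>

lemma coef_pascal:
  assumes "i + j > int k"
  shows "coef m n k i j = coef m n k (i - 1) j + coef m n k i (j - 1)"
proof -
  have "ibinom (i + j - int k) (i - int l)
      = ibinom (i - 1 + j - int k) (i - 1 - int l) + ibinom (i + (j - 1) - int k) (i - int l)" for l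
    using ibinom_pascal[of "i + j - int k" "i - int l"] assms by (simp add: algebra_simps)
  then show ?thesis
    unfolding coef_def sum.distrib[symmetric]
    by (intro sum.cong refl) (simp only: distrib_left distrib_right)
qed

text \<open>The Omega operator \<open>f_y g_x - f_x g_y\<close> written in coordinates:
  \<open>d/dx\<close> lowers the index with weight 1, while \<open>d/dy\<close> keeps the index and
  multiplies by the exponent of \<open>y\<close>, here \<open>m + 1 - i\<close> or
  \<open>n + 1 - j\<close>.\<close>

lemma coef_Suc:
  "(int k + 1) * coef (Suc m) (Suc n) (Suc k) i j
    = (int m + 1 - i) * coef m n k i (j - 1) - (int n + 1 - j) * coef m n k (i - 1) j"
proof -
  define q where "q = i + j - int k - 1"
  define U where "U l = ibinom (int m - int l) (int k - int l)" for l
  define V where "V l = ibinom (int n - int k + int l) (int l)" for l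
  define W where "W l = ibinom (int m + 1 - int l) (int k + 1 - int l)" for l
  have W: "(int k + 1 - int l) * W l = (int m + 1 - int l) * U l" for l
    using ibinom_absorb[of "int k + 1 - int l" "int m + 1 - int l"]
    by (simp add: U_def W_def algebra_simps)
  have W_Suc: "W (Suc l) = U l" for l
    by (simp add: U_def W_def)
  have V: "int (Suc l) * V (Suc l) = (int n - int k + int l + 1) * V l" for l
    using ibinom_absorb[of "int (Suc l)" "int n - int k + int (Suc l)"]
    by (simp add: V_def algebra_simps)
  have U_top: "U (Suc k) = 0"
    by (simp add: U_def ibinom_def)
  \<comment> \<open>Split \<open>k + 1 = (k + 1 - l) + l\<close>: the first part is absorbed by
    \<open>W\<close>, the second by \<open>V\<close>. The first sum then loses its top term and the
    second its bottom term, and shifting the latter aligns the two.\<close>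
  have "(int k + 1) * coef (Suc m) (Suc n) (Suc k) i j
      = (\<Sum>l\<le>Suc k. (- 1) ^ l * ibinom q (i - int l) * ((int k + 1 - int l) * W l) * V l)
        + (\<Sum>l\<le>Suc k. (- 1) ^ l * ibinom q (i - int l) * W l * (int l * V l))"
    unfolding coef_def sum.distrib[symmetric] sum_distrib_left atLeast0AtMost
    by (intro sum.cong refl) (simp add: q_def W_def V_def algebra_simps)
  also have "(\<Sum>l\<le>Suc k. (- 1) ^ l * ibinom q (i - int l) * ((int k + 1 - int l) * W l) * V l)
      = (\<Sum>l\<le>k. (- 1) ^ l * ibinom q (i - int l) * ((int m + 1 - int l) * U l) * V l)"
    unfolding W by (simp add: U_top)
  also have "(\<Sum>l\<le>Suc k. (- 1) ^ l * ibinom q (i - int l) * W l * (int l * V l))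
      = (\<Sum>l\<le>k. (- 1) ^ Suc l * ibinom q (i - int (Suc l)) * U l
          * ((int n - int k + int l + 1) * V l))"
    unfolding sum.atMost_Suc_shift W_Suc V by simp
  also have "(\<Sum>l\<le>k. (- 1) ^ l * ibinom q (i - int l) * ((int m + 1 - int l) * U l) * V l) + \<dots>
      = (\<Sum>l\<le>k. (- 1) ^ l * U l * V l *
          ((int m + 1 - int l) * ibinom q (i - int l)
            - (int n - int k + int l + 1) * ibinom q (i - int l - 1)))"
    unfolding sum.distrib[symmetric]
    by (intro sum.cong refl) (simp add: algebra_simps)
  \<comment> \<open>The weights become independent of \<open>l\<close>: they change by
    \<open>i - l\<close> and \<open>j - k + l\<close> respectively, and these two corrections cancel
    by \<open>ibinom_absorb_step\<close>.\<close>
  also have "\<dots> = (\<Sum>l\<le>k. (- 1) ^ l * U l * V l *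
          ((int m + 1 - i) * ibinom q (i - int l) - (int n + 1 - j) * ibinom q (i - int l - 1)))"
  proof (intro sum.cong refl arg_cong2[where f = "(*)"])
    fix l
    show "(int m + 1 - int l) * ibinom q (i - int l)
            - (int n - int k + int l + 1) * ibinom q (i - int l - 1)
        = (int m + 1 - i) * ibinom q (i - int l) - (int n + 1 - j) * ibinom q (i - int l - 1)"
      using ibinom_absorb_step[of "i - int l" q] by (simp add: q_def algebra_simps)
  qed
  also have "\<dots> = (int m + 1 - i) * coef m n k i (j - 1) - (int n + 1 - j) * coef m n k (i - 1) j"
    unfolding coef_def sum_subtractf[symmetric] sum_distrib_left atLeast0AtMost
    by (intro sum.cong refl) (simp add: q_def U_def V_def algebra_simps)
  finally show ?thesis .
qed

text \<open>Equivariance under \<open>x * d/dy\<close>, which sends basis vector \<open>i\<close> to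
  \<open>(i + 1) * (m - i)\<close> times basis vector \<open>i + 1\<close>. For \<open>k = 0\<close>
  it is absorption; the induction step says that the Omega operator commutes with
  \<open>x * d/dy\<close>.\<close>

lemma coef_raise:
  assumes "k \<le> m" "k \<le> n"
  shows "(i + 1) * (int m - i) * coef m n k (i + 1) j + (j + 1) * (int n - j) * coef m n k i (j + 1)
    = (i + j - int k + 1) * (int m + int n - int k - i - j) * coef m n k i j"
  using assms
proof (induction k arbitrary: m n i j)
  case 0
  have *: "(i + 1) * ibinom (i + j + 1) (i + 1) = (i + j + 1) * ibinom (i + j) i"
    using ibinom_absorb[of "i + 1" "i + j + 1"] by simp
  have **: "(j + 1) * ibinom (i + j + 1) i = (i + j + 1) * ibinom (i + j) i"
    using ibinom_absorb_comp[of "i + j + 1" i] by (simp add: algebra_simps)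
  have "(i + 1) * (int m - i) * ibinom (i + j + 1) (i + 1)
        + (j + 1) * (int n - j) * ibinom (i + j + 1) i
      = (int m - i) * ((i + 1) * ibinom (i + j + 1) (i + 1))
        + (int n - j) * ((j + 1) * ibinom (i + j + 1) i)"
    by (simp add: algebra_simps)
  also have "\<dots> = (i + j + 1) * (int m + int n - i - j) * ibinom (i + j) i"
    unfolding * ** by (simp add: algebra_simps)
  finally show ?case
    by (simp add: coef_zero add.assoc add.commute add.left_commute)
next
  case (Suc k)
  obtain M N where mn: "m = Suc M" "n = Suc N"
    using Suc.prems by (meson Suc_le_D)
  define C where "C = coef M N k"
  define D where "D = coef m n (Suc k)"
  have D: "(int k + 1) * D i j = (int M + 1 - i) * C i (j - 1) - (int N + 1 - j) * C (i - 1) j" for i j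
    unfolding C_def D_def mn by (rule coef_Suc)
  have IH: "(i + 1) * (int M - i) * C (i + 1) j + (j + 1) * (int N - j) * C i (j + 1)
    = (i + j - int k + 1) * (int M + int N - int k - i - j) * C i j" for i j
    unfolding C_def using Suc.prems mn by (intro Suc.IH) auto
  have IH1: "(i + 1) * (int M - i) * C (i + 1) (j - 1) + j * (int N + 1 - j) * C i j
    = (i + j - int k) * (int M + int N + 1 - int k - i - j) * C i (j - 1)"
    using IH[of i "j - 1"] by (simp add: algebra_simps)
  have IH2: "i * (int M + 1 - i) * C i j + (j + 1) * (int N - j) * C (i - 1) (j + 1)
    = (i + j - int k) * (int M + int N + 1 - int k - i - j) * C (i - 1) j"
    using IH[of "i - 1" j] by (simp add: algebra_simps)
  have D1: "(int k + 1) * D (i + 1) j = (int M - i) * C (i + 1) (j - 1) - (int N + 1 - j) * C i j"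
    using D[of "i + 1" j] by simp
  have D2: "(int k + 1) * D i (j + 1) = (int M + 1 - i) * C i j - (int N - j) * C (i - 1) (j + 1)"
    using D[of i "j + 1"] by simp
  have "(int k + 1) * ((i + 1) * (int M + 1 - i) * D (i + 1) j
        + (j + 1) * (int N + 1 - j) * D i (j + 1))
      = (i + 1) * (int M + 1 - i) * ((int k + 1) * D (i + 1) j)
        + (j + 1) * (int N + 1 - j) * ((int k + 1) * D i (j + 1))"
    by (simp add: algebra_simps)
  \<comment> \<open>\<open>C i j\<close> occurs in both expansions, with total weight
    \<open>(j + 1) - (i + 1) = j - i\<close> up to the common factor. Redistributing it as
    \<open>j\<close> and \<open>- i\<close> produces exactly the left sides of \<open>IH1\<close>
    and \<open>IH2\<close>.\<close>
  also have "\<dots> = (int M + 1 - i) * ((i + 1) * (int M - i) * C (i + 1) (j - 1)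
        + j * (int N + 1 - j) * C i j)
      - (int N + 1 - j) * (i * (int M + 1 - i) * C i j + (j + 1) * (int N - j) * C (i - 1) (j + 1))"
    unfolding D1 D2 by (simp add: algebra_simps)
  also have "\<dots> = (i + j - int k) * (int M + int N + 1 - int k - i - j) * ((int k + 1) * D i j)"
    unfolding IH1 IH2 D by (simp add: algebra_simps)
  also have "\<dots> = (int k + 1) * ((i + j - int k) * (int M + int N + 1 - int k - i - j) * D i j)"
    by (rule mult.left_commute)
  finally have *: "(int k + 1) * ((i + 1) * (int M + 1 - i) * D (i + 1) j
        + (j + 1) * (int N + 1 - j) * D i (j + 1))
      = (int k + 1) * ((i + j - int k) * (int M + int N + 1 - int k - i - j) * D i j)" .
  have "(i + 1) * (int M + 1 - i) * D (i + 1) j + (j + 1) * (int N + 1 - j) * D i (j + 1)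
      = (i + j - int k) * (int M + int N + 1 - int k - i - j) * D i j"
    using * unfolding mult_cancel_left by auto
  then show ?case
    by (simp add: D_def mn algebra_simps)
qed

text \<open>Two Omega steps preserve the parity of \<open>k\<close> and raise \<open>m / 2\<close>
  and \<open>n / 2\<close> by one, so centres of odd levels can be compared. The two mixed terms
  coincide, hence the factor 2.\<close>

lemma coef_Suc_Suc:
  "(int k + 1) * (int k + 2) * coef (m + 2) (n + 2) (k + 2) i j
    = (int m + 2 - i) * (int m + 1 - i) * coef m n k i (j - 2)
      - 2 * (int m + 2 - i) * (int n + 2 - j) * coef m n k (i - 1) (j - 1)
      + (int n + 2 - j) * (int n + 1 - j) * coef m n k (i - 2) j"
proof -
  define x y z where "x = coef m n k i (j - 2)" and "y = coef m n k (i - 1) (j - 1)"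
    and "z = coef m n k (i - 2) j"
  define d e where "d = coef (Suc m) (Suc n) (Suc k) i (j - 1)"
    and "e = coef (Suc m) (Suc n) (Suc k) (i - 1) j"
  define w where "w = coef (m + 2) (n + 2) (k + 2) i j"
  have "(int k + 2) * w = (int m + 2 - i) * d - (int n + 2 - j) * e"
    using coef_Suc[of "Suc k" "Suc m" "Suc n" i j] by (simp add: w_def d_def e_def algebra_simps)
  moreover have "(int k + 1) * d = (int m + 1 - i) * x - (int n + 2 - j) * y"
    using coef_Suc[of k m n i "j - 1"] by (simp add: d_def x_def y_def algebra_simps)
  moreover have "(int k + 1) * e = (int m + 2 - i) * y - (int n + 1 - j) * z"
    using coef_Suc[of k m n "i - 1" j] by (simp add: e_def y_def z_def algebra_simps)
  ultimately have "(int k + 1) * (int k + 2) * w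
      = (int m + 2 - i) * (int m + 1 - i) * x - 2 * (int m + 2 - i) * (int n + 2 - j) * y
        + (int n + 2 - j) * (int n + 1 - j) * z"
    \<comment> \<open>qualified because HOL-Algebra shadows the method name\<close>
    by Groebner_Basis.algebra
  then show ?thesis
    unfolding w_def x_def y_def z_def .
qed

section \<open>Values at the centre and directly below it\<close>

text \<open>Induction in double steps: at the new centre \<open>coef_Suc_Suc\<close> involves the
  old centre and its two diagonal neighbours in the same column. Since the old centre vanishes,
  Pascal's rule replaces these neighbours by the entries in \<open>coef_raise\<close> at the old
  centre, with the same weights, and that sum is zero.\<close>

lemma coef_central_eq_0:
  assumes "r < a" "r < b"
  shows "coef (2 * a) (2 * b) (2 * r + 1) (int a) (int b) = 0"
  using assms
proof (induction r arbitrary: a b)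
  case 0
  obtain m n where mn: "2 * a = Suc m" "2 * b = Suc n"
    using 0 by (metis Suc_pred nat_0_less_mult_iff zero_less_numeral)
  then have "int m = 2 * int a - 1" "int n = 2 * int b - 1"
    by linarith+
  then have "coef (2 * a) (2 * b) 1 (int a) (int b)
      = int a * ibinom (int a + int b - 1) (int a) - int b * ibinom (int a + int b - 1) (int a - 1)"
    using coef_Suc[of 0 m n "int a" "int b", folded mn]
    by (simp add: coef_zero algebra_simps)
  with ibinom_absorb_step[of "int a" "int a + int b - 1"] show ?case
    by simp
next
  case (Suc r)
  then obtain a' b' where ab: "a = Suc a'" "b = Suc b'" and r: "r < a'" "r < b'"
    by (metis Suc_lessE Suc_lessD)
  define C where "C = coef (2 * a') (2 * b') (2 * r + 1)"
  have C0: "C (int a') (int b') = 0"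
    unfolding C_def using r by (rule Suc.IH)
  have pascal1: "C (int a' + 1) (int b') = C (int a' + 1) (int b' - 1)"
    using coef_pascal[of "2 * r + 1" "int a' + 1" "int b'" "2 * a'" "2 * b'"] r C0
    by (simp add: C_def)
  have pascal2: "C (int a') (int b' + 1) = C (int a' - 1) (int b' + 1)"
    using coef_pascal[of "2 * r + 1" "int a'" "int b' + 1" "2 * a'" "2 * b'"] r C0
    by (simp add: C_def)
  have "(int a' + 1) * int a' * C (int a' + 1) (int b') + (int b' + 1) * int b' * C (int a') (int b' + 1)
      = 0"
    using coef_raise[of "2 * r + 1" "2 * a'" "2 * b'" "int a'" "int b'"] r C0
    by (simp add: C_def)
  with pascal1 pascal2 C0 coef_Suc_Suc[of "2 * r + 1" "2 * a'" "2 * b'" "int a" "int b"]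
  have "(int (2 * r + 1) + 1) * (int (2 * r + 1) + 2)
      * coef (2 * a) (2 * b) (2 * Suc r + 1) (int a) (int b) = 0"
    unfolding ab by (simp add: C_def algebra_simps)
  then show ?case
    by auto
qed

text \<open>The closed form of \<open>X\<close> with denominators cleared, where
  \<open>u = (m - k - 1) / 2\<close> and \<open>v = (n - k - 1) / 2\<close>. Raising
  \<open>m\<close>, \<open>n\<close> and \<open>k\<close> by 2 leaves \<open>u\<close> and
  \<open>v\<close> fixed, so induction on \<open>r\<close> alone suffices.\<close>

lemma coef_below_central:
  "(int r + int u + 1) * (int r + int u + 2) *
    coef (2 * (r + u + 1)) (2 * (r + v + 1)) (2 * r + 1) (int r + int u + 2) (int r + int v)
    * (fact r * fact u * fact v) = 2 * (- 1) ^ (r + 1) * fact (r + u + v + 2)"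
proof (induction r)
  case 0
  define c where "c = coef (2 * (u + 1)) (2 * (v + 1)) 1 (int u + 2) (int v)"
  define p w where "p = ibinom (int u + int v + 1) (int u + 1)"
    and "w = ibinom (int u + int v + 1) (int u + 2)"
  have "c = int u * w - (int v + 2) * p"
    using coef_Suc[of 0 "2 * u + 1" "2 * v + 1" "int u + 2" "int v"]
    by (simp add: c_def p_def w_def coef_zero algebra_simps)
  moreover have "(int u + 2) * w = int v * p"
    using ibinom_absorb_step[of "int u + 2" "int u + int v + 1"] by (simp add: p_def w_def add.commute)
  \<comment> \<open>The constant comes from
    \<open>u * v - (u + 2) * (v + 2) = - 2 * (u + v + 2)\<close>.\<close>
  ultimately have "(int u + 2) * c = - 2 * (int u + int v + 2) * p"
    by Groebner_Basis.algebra
  moreover have "p * (fact (u + 1) * fact v) = fact (u + v + 1)"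
  proof -
    have "p = int ((u + v + 1) choose (u + 1))"
      by (simp add: p_def ibinom_def nat_add_distrib)
    then show ?thesis
      using binomial_fact_lemma[of "u + 1" "u + v + 1"]
      by (metis (no_types, opaque_lifting) of_nat_mult of_nat_fact mult.commute
          add_diff_cancel_left' add.assoc add.commute le_add1)
  qed
  moreover have "fact (u + 1) = (int u + 1) * fact u"
      "fact (u + v + 2) = (int u + int v + 2) * fact (u + v + 1)"
    by (simp_all add: algebra_simps)
  ultimately have "(int u + 1) * (int u + 2) * c * (fact u * fact v) = - 2 * fact (u + v + 2)"
    by Groebner_Basis.algebra
  then show ?case
    by (simp add: c_def)
next
  case (Suc r)
  define a b where "a = r + u + 1" and "b = r + v + 1"
  define C where "C = coef (2 * a) (2 * b) (2 * r + 1)"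
  define X where "X = coef (2 * (a + 1)) (2 * (b + 1)) (2 * r + 3) (int a + 2) (int b)"
  define Y where "Y = C (int a + 1) (int b - 1)"
  define y z where "y = C (int a + 2) (int b - 1)" and "z = C (int a + 2) (int b - 2)"
  have ab: "r < a" "r < b"
    by (simp_all add: a_def b_def)
  have C0: "C (int a) (int b) = 0"
    unfolding C_def using ab by (rule coef_central_eq_0)
  have pascal1: "C (int a + 1) (int b) = Y"
    using coef_pascal[of "2 * r + 1" "int a + 1" "int b" "2 * a" "2 * b"] ab C0
    by (simp add: C_def Y_def)
  have pascal2: "y = Y + z"
    using coef_pascal[of "2 * r + 1" "int a + 2" "int b - 1" "2 * a" "2 * b"] ab
    by (simp add: C_def Y_def y_def z_def add.commute)
  have raise: "(int a + 2) * (int a - 1) * y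
      + int b * (int b + 1) * Y
      = (int a + int b - 2 * int r) * (int a + int b - 2 * int r - 1) * Y"
    using coef_raise[of "2 * r + 1" "2 * a" "2 * b" "int a + 1" "int b - 1"] ab pascal1
    by (simp add: C_def Y_def y_def algebra_simps)
  have omega: "(2 * int r + 2) * (2 * int r + 3) * X
      = int a * (int a - 1) * z - 2 * int a * (int b + 2) * Y"
    using coef_Suc_Suc[of "2 * r + 1" "2 * a" "2 * b" "int a + 2" "int b"] C0
    by (simp add: C_def Y_def X_def z_def algebra_simps numeral_3_eq_3)
  \<comment> \<open>With \<open>T = a + b\<close> and \<open>S = T - 2 * r\<close>, eliminating
    \<open>y\<close> and \<open>z\<close> leaves \<open>a * Y\<close> times
    \<open>S * (S - 1) - (T + 2) * (T + 3)\<close>, which factors as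
    \<open>- 2 * (2 * r + 3) * (T + 1 - r)\<close>. The factor \<open>2 * (2 * r + 3)\<close> also
    occurs on the left and is cancelled next.\<close>
  have "(2 * (2 * int r + 3)) * ((int a + 2) * ((int r + 1) * X))
      = (2 * (2 * int r + 3)) * (- int a * (int a + int b + 1 - int r) * Y)"
    using raise omega pascal2 by Groebner_Basis.algebra
  then have X_Y: "(int a + 2) * ((int r + 1) * X) = - int a * (int a + int b + 1 - int r) * Y"
    by (subst (asm) mult_cancel_left) auto
  have IH: "int a * (int a + 1) * Y * (fact r * fact u * fact v)
      = 2 * (- 1) ^ (r + 1) * fact (r + u + v + 2)"
    using Suc.IH by (simp add: C_def Y_def a_def b_def algebra_simps)
  have "(int a + 1) * (int a + 2) * X * (fact (Suc r) * fact u * fact v)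
      = (int a + 1) * ((int a + 2) * ((int r + 1) * X)) * (fact r * fact u * fact v)"
    by (simp add: algebra_simps)
  also have "\<dots> = - (int a + int b + 1 - int r) * (int a * (int a + 1) * Y * (fact r * fact u * fact v))"
    unfolding X_Y by (simp add: algebra_simps)
  \<comment> \<open>Here \<open>a + b + 1 - r\<close> is \<open>Suc r + u + v + 2\<close>, the next
    factor of the factorial.\<close>
  also have "\<dots> = 2 * (- 1) ^ (Suc r + 1) * (int (Suc r + u + v + 2) * fact (r + u + v + 2))"
    unfolding IH by (simp add: a_def b_def algebra_simps)
  also have "\<dots> = 2 * (- 1) ^ (Suc r + 1) * fact (Suc r + u + v + 2)"
    by simp
  finally show ?case
    by (simp add: X_def a_def b_def algebra_simps numeral_3_eq_3)
qed

section \<open>Matrix entries, closed form and recursion\<close>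

theorem theorem5:
  fixes m n k m' :: nat and X :: rat and A B :: "nat \<Rightarrow> rat"
  assumes "even m" and "even n" and "odd k" and "1 \<le> k" and "k \<le> min m n"
    and m': "m' = m + n - 2 * k"
    and X: "X = of_int (M_mat m n k $$ (m div 2 + 1, m' div 2))"
    and A: "\<And>s. 1 \<le> s \<Longrightarrow> s \<le> m div 2 \<Longrightarrow>
      A s * X = of_int (M_mat m n k $$ (m div 2 + s, m' div 2))"
    and B: "\<And>s. 1 \<le> s \<Longrightarrow> s \<le> m div 2 \<Longrightarrow>
      B s * X = of_int (M_mat m n k $$ (m div 2 + s, m' div 2 + 1))"
  shows "M_mat m n k $$ (m div 2, m' div 2) = coef m n k (int m div 2) (int n div 2) \<and>
    coef m n k (int m div 2) (int n div 2) = 0 \<and>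
    X = of_int (coef m n k (int m div 2 + 1) (int n div 2 - 1)) \<and>
    X = (- 1) ^ ((k + 1) div 2)
      * (2 * (of_nat k + 1) * (of_nat m - of_nat k + 1) / (of_nat m * (of_nat m + 2)))
      * (fact ((m + n - k + 1) div 2)
          / (fact ((m - k + 1) div 2) * fact ((n - k - 1) div 2) * fact ((k + 1) div 2))) \<and>
    (\<forall>s. 1 \<le> s \<and> s \<le> m div 2 \<longrightarrow>
      A s * X = of_int (coef_ext m n k (int m div 2 + int s) (int n div 2 - int s))) \<and>
    (\<forall>s. 1 \<le> s \<and> s \<le> m div 2 \<longrightarrow>
      B s * X = of_int (coef_ext m n k (int m div 2 + int s) (int n div 2 - int s + 1))) \<and>
    A 1 = 1 \<and>
    B 1 = 1 \<and>
    (\<forall>s. 1 \<le> s \<and> s < m div 2 \<longrightarrow>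
      A (s + 1) =
        ((lam (of_nat m') - lam (of_nat m) + lam (2 * of_nat s)) * A s
          - (lam (of_nat n) - lam (2 * of_nat s - 2)) * B s)
        / (lam (of_nat m) - lam (2 * of_nat s))) \<and>
    (\<forall>s. 1 \<le> s \<and> s < m div 2 \<longrightarrow>
      B (s + 1) =
        (lam (of_nat m') * A s - (lam (of_nat n) - lam (2 * of_nat s - 2)) * B s)
        / (lam (of_nat m) - lam (2 * of_nat s)))"
proof -
  obtain a b r where abr: "m = 2 * a" "n = 2 * b" "k = 2 * r + 1"
    using \<open>even m\<close> \<open>even n\<close> \<open>odd k\<close> by (auto elim!: evenE oddE)
  have "r < a" "r < b"
    using \<open>k \<le> min m n\<close> abr by auto
  then obtain u v where uv: "a = r + u + 1" "b = r + v + 1"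
    by (metis less_imp_Suc_add add_Suc_right Suc_eq_plus1)
  define q where "q = u + v + 1"
  have m'_q: "m' = 2 * q"
    by (simp add: m' abr uv q_def)
  define C where "C = coef m n k"
  have M_eq: "M_mat m n k $$ (a + s, q + d) = coef_ext m n k (int a + int s) (int b - int s + int d)"
    if "s \<le> a" "d \<le> 1" for s d
    using that by (simp add: M_mat_def abr uv q_def algebra_simps)
  \<comment> \<open>Here \<open>j\<close> is at most \<open>b + 1\<close>, hence at most
    \<open>n\<close> because \<open>b\<close> is positive; negative \<open>j\<close> is covered by
    \<open>coef_eq_0\<close>.\<close>
  have M_C: "M_mat m n k $$ (a + s, q + d) = C (int a + int s) (int b - int s + int d)"
    if "s \<le> a" "d \<le> 1" for s d
    unfolding M_eq[OF that] using that by (auto simp: coef_ext_def C_def coef_eq_0 abr(2) uv(2))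
  have C0: "C (int a) (int b) = 0"
    unfolding C_def abr using \<open>r < a\<close> \<open>r < b\<close> by (rule coef_central_eq_0)
  have X_C: "X = of_int (C (int a + 1) (int b - 1))"
    using M_C[of 1 0] by (simp add: X abr(1) m'_q uv)
  have A_C: "A s * X = of_int (C (int a + int s) (int b - int s))" if "1 \<le> s" "s \<le> a" for s
    using A[of s] M_C[of s 0] that by (simp add: abr(1) m'_q)
  have B_C: "B s * X = of_int (C (int a + int s) (int b - int s + 1))" if "1 \<le> s" "s \<le> a" for s
    using B[of s] M_C[of s 1] that by (simp add: abr(1) m'_q)
  have "(int r + int u + 1) * (int r + int u + 2) *
      C (int a + 1) (int b - 1) * (fact r * fact u * fact v)
      = 2 * (- 1) ^ (r + 1) * fact (r + u + v + 2)"
    using coef_below_central[of r u v] by (simp add: C_def abr uv add.commute add.left_commute)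
  from arg_cong[OF this, of "of_int :: int \<Rightarrow> rat"]
  have X_fact: "(of_nat r + of_nat u + 1) * (of_nat r + of_nat u + 2) * X * (fact r * fact u * fact v)
      = (2 * (- 1) ^ (r + 1) * fact (r + u + v + 2) :: rat)"
    by (simp only: X_C of_int_mult of_int_add of_int_of_nat_eq of_int_1 of_int_numeral of_int_fact
        of_int_power of_int_minus)
  \<comment> \<open>The right side of \<open>X_fact\<close> is nonzero, so every factor on the left
    is. This permits cancelling \<open>X\<close>, through which alone \<open>A\<close> and
    \<open>B\<close> are specified.\<close>
  then have X_nz: "X \<noteq> 0"
    by auto
  have nz: "(of_nat r + of_nat u + 1 :: rat) \<noteq> 0" "(of_nat r + of_nat u + 2 :: rat) \<noteq> 0"
    using X_fact by auto
  have X_form: "X = (- 1) ^ ((k + 1) div 2)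
      * (2 * (of_nat k + 1) * (of_nat m - of_nat k + 1) / (of_nat m * (of_nat m + 2)))
      * (fact ((m + n - k + 1) div 2)
          / (fact ((m - k + 1) div 2) * fact ((n - k - 1) div 2) * fact ((k + 1) div 2)))"
  proof -
    have "(k + 1) div 2 = r + 1" "(m + n - k + 1) div 2 = r + u + v + 2"
      "(m - k + 1) div 2 = u + 1" "(n - k - 1) div 2 = v"
      by (simp_all add: abr uv)
    moreover have "(of_nat k + 1 :: rat) = 2 * (of_nat r + 1)"
      "(of_nat m - of_nat k + 1 :: rat) = 2 * (of_nat u + 1)"
      "(of_nat m :: rat) = 2 * (of_nat r + of_nat u + 1)"
      "(of_nat m + 2 :: rat) = 2 * (of_nat r + of_nat u + 2)"
      by (simp_all add: abr uv)
    moreover have "X = 2 * (- 1) ^ (r + 1) * fact (r + u + v + 2)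
        / ((of_nat r + of_nat u + 1) * (of_nat r + of_nat u + 2) * (fact r * fact u * fact v))"
      using X_fact nz by (subst eq_divide_eq) (simp add: mult_ac)
    moreover have "(fact (u + 1) :: rat) = (of_nat u + 1) * fact u"
      "(fact (r + 1) :: rat) = (of_nat r + 1) * fact r"
      by (simp_all add: algebra_simps)
    moreover have "(of_nat u + 1 :: rat) \<noteq> 0" "(of_nat r + 1 :: rat) \<noteq> 0"
      by (metis of_nat_Suc of_nat_neq_0 add.commute)+
    ultimately show ?thesis
      using nz by (simp only:) (simp add: divide_simps, simp add: algebra_simps)
  qed
  have A1: "A 1 = 1"
    using A_C[of 1] X_C X_nz by (simp add: uv)
  have "C (int a + 1) (int b) = C (int a + 1) (int b - 1)"
    using coef_pascal[of k "int a + 1" "int b" m n] C0 by (simp add: C_def abr uv)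
  then have B1: "B 1 = 1"
    using B_C[of 1] X_C X_nz \<open>r < a\<close> by simp
  have step: "A (s + 1) = ((lam (of_nat m') - lam (of_nat m) + lam (2 * of_nat s)) * A s
          - (lam (of_nat n) - lam (2 * of_nat s - 2)) * B s)
        / (lam (of_nat m) - lam (2 * of_nat s)) \<and>
      B (s + 1) = (lam (of_nat m') * A s - (lam (of_nat n) - lam (2 * of_nat s - 2)) * B s)
        / (lam (of_nat m) - lam (2 * of_nat s))"
    if s: "1 \<le> s" "s < a" for s
  proof -
    \<comment> \<open>This is the weight \<open>(i + 1) * (m - i)\<close> of
      \<open>coef_raise\<close> at \<open>i = a + s\<close>, nonzero because
      \<open>s < a\<close>.\<close>
    define d :: rat where "d = (of_nat a + of_nat s + 1) * (of_nat a - of_nat s)"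
    have d: "lam (of_nat m) - lam (2 * of_nat s) = 4 * d"
      by (simp add: lam_def abr d_def algebra_simps)
    have "(of_nat a + of_nat s + 1 :: rat) = of_nat (a + s + 1)"
      "(of_nat a - of_nat s :: rat) = of_nat (a - s)"
      using s by (simp_all add: of_nat_diff)
    then have "d \<noteq> 0"
      unfolding d_def using s by (simp only: mult_eq_0_iff of_nat_eq_0_iff) simp
    \<comment> \<open>Pascal's rule in the row below: \<open>B (s + 1) = A s + A (s + 1)\<close>
      after division by \<open>X\<close>.\<close>
    have "C (int a + int (s + 1)) (int b - int s)
        = C (int a + int s) (int b - int s) + C (int a + int (s + 1)) (int b - int (s + 1))"
      using coef_pascal[of k "int a + int (s + 1)" "int b - int s" m n]
      by (simp add: C_def abr uv algebra_simps)
    then have "B (s + 1) * X = (A s + A (s + 1)) * X"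
      using A_C[of s] A_C[of "s + 1"] B_C[of "s + 1"] s by (simp add: distrib_right)
    then have AB: "A (s + 1) = B (s + 1) - A s"
      using X_nz by simp
    \<comment> \<open>The raising identity at the position of \<open>A s\<close> involves
      \<open>B (s + 1)\<close>, \<open>B s\<close> and \<open>A s\<close> only, so it determines
      \<open>B (s + 1)\<close>.\<close>
    have "(int a + int s + 1) * (int a - int s) * C (int a + int (s + 1)) (int b - int s)
        + (int b - int s + 1) * (int b + int s) * C (int a + int s) (int b - int s + 1)
        = (int q + 1) * int q * C (int a + int s) (int b - int s)"
      using coef_raise[of k m n "int a + int s" "int b - int s"]
      by (simp add: C_def abr uv q_def algebra_simps)
    from arg_cong[OF this, of "of_int :: int \<Rightarrow> rat"]
    have "(d * B (s + 1)) * X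
        + ((of_nat b - of_nat s + 1) * (of_nat b + of_nat s) * B s) * X
        = ((of_nat q + 1) * of_nat q * A s) * X"
      using A_C[of s] B_C[of s] B_C[of "s + 1"] s
      by (simp add: d_def mult.assoc)
    then have raise: "d * B (s + 1) + (of_nat b - of_nat s + 1) * (of_nat b + of_nat s) * B s
        = (of_nat q + 1) * of_nat q * A s"
      using X_nz by (simp add: distrib_right[symmetric])
    have n: "lam (of_nat n) - lam (2 * of_nat s - 2)
        = 4 * ((of_nat b - of_nat s + 1) * (of_nat b + of_nat s))"
      by (simp add: lam_def abr algebra_simps)
    have m': "lam (of_nat m') = 4 * ((of_nat q + 1) * of_nat q)"
      by (simp add: lam_def m'_q algebra_simps)
    have B_step: "4 * d * B (s + 1) = lam (of_nat m') * A s
        - (lam (of_nat n) - lam (2 * of_nat s - 2)) * B s"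
      unfolding n m' using raise by Groebner_Basis.algebra
    \<comment> \<open>Subtracting \<open>4 * d * A s\<close> from \<open>B_step\<close> accounts for
      the extra terms in the weight of \<open>A s\<close>.\<close>
    moreover have "4 * d * A (s + 1) = (lam (of_nat m') - lam (of_nat m) + lam (2 * of_nat s)) * A s
        - (lam (of_nat n) - lam (2 * of_nat s - 2)) * B s"
      using B_step AB d by Groebner_Basis.algebra
    ultimately show ?thesis
      unfolding d using \<open>d \<noteq> 0\<close> by (simp add: field_simps)
  qed
  have half: "int m div 2 = int a" "int n div 2 = int b" "m div 2 = a" "m' div 2 = q"
    by (simp_all add: abr m'_q)
  show ?thesis
    unfolding half
    using M_C[of 0 0] C0 X_C X_form A1 B1 step A B M_eq[of _ 0] M_eq[of _ 1]
    by (simp add: C_def half)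
qed

end
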